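(* Let $G$ be a group. There is an amenable subgroup $H$ of $G$ such that for every finite amenably-visible subset $S$ of $G$ and every $\gamma\in G$, the conjugate $H^\gamma=\gamma^{-1}H\gamma$ has non-empty intersection with $S$.
   Context: Groups are discrete. A finite subset $S$ of a group $G$ is called amenably-visible if there is an amenable subgroup $K$ of $G$ (possibly depending on $S$) such that $S\cap K^\gamma\neq\varnothing$ for all $\gamma\in G$, where $K^\gamma=\gamma^{-1}K\gamma$. *)

theory Defs
  imports Complex_Main "HOL-Algebra.Coset"
begin

definition bounded_functions :: "('a, 'b) monoid_scheme \<Rightarrow> ('a \<Rightarrow> real) set" where
  "bounded_functions G = {f. \<exists>C. \<forall>x\<in>carrier G. \<bar>f x\<bar> \<le> C}"

text \<open>
  A mean is given on total functions, but by linearity and positivity its value depends only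
  on the restriction of the function to the carrier, so this is an invariant mean on
  the space of bounded real functions on the discrete group.
\<close>

definition left_invariant_mean ::
    "('a, 'b) monoid_scheme \<Rightarrow> (('a \<Rightarrow> real) \<Rightarrow> real) \<Rightarrow> bool" where
  "left_invariant_mean G m \<longleftrightarrow>
     (\<forall>f\<in>bounded_functions G. \<forall>h\<in>bounded_functions G. m (\<lambda>x. f x + h x) = m f + m h) \<and>
     (\<forall>c. \<forall>f\<in>bounded_functions G. m (\<lambda>x. c * f x) = c * m f) \<and>
     (\<forall>f\<in>bounded_functions G. (\<forall>x\<in>carrier G. 0 \<le> f x) \<longrightarrow> 0 \<le> m f) \<and>
     m (\<lambda>_. 1) = 1 \<and>
     (\<forall>a\<in>carrier G. \<forall>f\<in>bounded_functions G. m (\<lambda>x. f (a \<otimes>\<^bsub>G\<^esub> x)) = m f)"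

definition amenable :: "('a, 'b) monoid_scheme \<Rightarrow> bool" where
  "amenable G \<longleftrightarrow> group G \<and> (\<exists>m. left_invariant_mean G m)"

definition amenable_subgroup :: "'a set \<Rightarrow> ('a, 'b) monoid_scheme \<Rightarrow> bool" where
  "amenable_subgroup K G \<longleftrightarrow> subgroup K G \<and> amenable (G\<lparr>carrier := K\<rparr>)"

definition conjugate :: "('a, 'b) monoid_scheme \<Rightarrow> 'a set \<Rightarrow> 'a \<Rightarrow> 'a set" where
  "conjugate G K \<gamma> = (inv\<^bsub>G\<^esub> \<gamma> <#\<^bsub>G\<^esub> K) #>\<^bsub>G\<^esub> \<gamma>"

definition amenably_visible :: "('a, 'b) monoid_scheme \<Rightarrow> 'a set \<Rightarrow> bool" where
  "amenably_visible G S \<longleftrightarrow> finite S \<and> S \<subseteq> carrier G \<and>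
     (\<exists>K. amenable_subgroup K G \<and> (\<forall>\<gamma>\<in>carrier G. S \<inter> conjugate G K \<gamma> \<noteq> {}))"

end

theory Submission
  imports Defs "HOL-Analysis.Analysis"
begin

text \<open>
  The means on the bounded functions of \<open>G\<close> form a compact convex set on which \<open>G\<close> acts by affine
  homeomorphisms. Let \<open>Q\<close> be a minimal non-empty closed convex invariant subset and \<open>x\<close> an extreme
  point of \<open>Q\<close>; then \<open>H\<close> is the stabilizer of \<open>x\<close>, which is amenable because \<open>x\<close>, pulled
  back along an \<open>H\<close>-equivariant map \<open>G \<rightarrow> H\<close>, is an invariant mean. If \<open>S\<close> is
  visible through \<open>K\<close>, then \<open>K\<close> fixes a point \<open>p\<close> of \<open>Q\<close>, so every point of the orbit of \<open>p\<close>
  is fixed by some element of \<open>S\<close>. The fixed point sets in \<open>Q\<close> of the finitely many elements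
  of \<open>S\<close> are compact and convex, hence so is the convex hull of their union. By minimality this
  hull is all of \<open>Q\<close>, and the extreme point \<open>x\<close> must lie in one of the fixed point sets.
\<close>

section \<open>Compactness and minimal closed sets\<close>

lemma compact_fun_imp_closed:
  fixes S :: "('i \<Rightarrow> 'b::t2_space) set"
  assumes "compact S"
  shows "closed S"
proof -
  have "Hausdorff_space (euclidean :: ('i \<Rightarrow> 'b) topology)"
    unfolding euclidean_product_topology[symmetric] Hausdorff_space_product_topology
    by (auto simp: Hausdorff_space_def disjnt_def) (meson hausdorff)
  then show ?thesis
    using assms compactin_imp_closedin[of euclidean S] by simp
qed

text \<open>Zorn's lemma for reverse inclusion; by compactness a chain of non-empty closed sets has
  non-empty intersection. \<open>P\<close> is left abstract because the lemma serves twice: for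
  faces, to get extreme points, and for convex invariant sets.\<close>

lemma minimal_nonempty_closed_subset:
  assumes "compact M" "closed M" "M \<noteq> {}" "P M"
    and Inter: "\<And>\<C>. \<C> \<noteq> {} \<Longrightarrow> (\<And>A. A \<in> \<C> \<Longrightarrow> P A) \<Longrightarrow> P (\<Inter>\<C>)"
  obtains Q where "Q \<subseteq> M" "closed Q" "Q \<noteq> {}" "P Q"
    "\<And>A. A \<subseteq> Q \<Longrightarrow> closed A \<Longrightarrow> A \<noteq> {} \<Longrightarrow> P A \<Longrightarrow> A = Q"
proof -
  define X where "X = {A. A \<subseteq> M \<and> closed A \<and> A \<noteq> {} \<and> P A}"
  have "\<exists>Q\<in>X. \<forall>A\<in>X. A \<subseteq> Q \<longrightarrow> A = Q"
  proof (rule predicate_Zorn[where P = "\<lambda>A B. B \<subseteq> A"])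
    show "partial_order_on X (relation_of (\<lambda>A B. B \<subseteq> A) X)"
      by (auto simp: partial_order_on_def preorder_on_def refl_on_def trans_def antisym_def
          relation_of_def)
  next
    fix \<C> assume "\<C> \<in> Chains (relation_of (\<lambda>A B. B \<subseteq> A) X)"
    then have CX: "\<C> \<subseteq> X" and chain: "\<And>A B. A \<in> \<C> \<Longrightarrow> B \<in> \<C> \<Longrightarrow> A \<subseteq> B \<or> B \<subseteq> A"
      by (auto simp: Chains_def relation_of_def)
    show "\<exists>U\<in>X. \<forall>A\<in>\<C>. U \<subseteq> A"
    proof (cases "\<C> = {}")
      case True
      then show ?thesis using assms by (auto simp: X_def)
    next
      case False
      have "M \<inter> \<Inter>\<C> \<noteq> {}"
      proof (rule compact_imp_fip[OF \<open>compact M\<close>])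
        show "closed T" if "T \<in> \<C>" for T using that CX by (auto simp: X_def)
      next
        fix \<F> assume "finite \<F>" "\<F> \<subseteq> \<C>"
        \<comment> \<open>A finite non-empty subfamily of a chain has a least member, which is its
          own intersection.\<close>
        then have "\<F> = {} \<or> \<Inter>\<F> \<in> \<F>"
        proof (induction \<F>)
          case (insert A \<F>)
          then consider "\<F> = {}" | "\<Inter>\<F> \<in> \<F>" "A \<subseteq> \<Inter>\<F> \<or> \<Inter>\<F> \<subseteq> A"
            using chain[of A "\<Inter>\<F>"] by blast
          then show ?case
            by cases (simp, metis Inter_insert inf.absorb1 inf.absorb2 insert_iff)
        qed simp
        then consider "\<F> = {}" | "\<Inter>\<F> \<in> X"
          using CX \<open>\<F> \<subseteq> \<C>\<close> by blast
        then show "M \<inter> \<Inter>\<F> \<noteq> {}"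
          using \<open>M \<noteq> {}\<close> by cases (auto simp: X_def Int_absorb1)
      qed
      moreover have "P (\<Inter>\<C>)" using False CX by (intro Inter) (auto simp: X_def)
      moreover have "closed (\<Inter>\<C>)" using CX by (intro closed_Inter) (auto simp: X_def)
      moreover have "\<Inter>\<C> \<subseteq> M" using False CX by (auto simp: X_def)
      ultimately have "\<Inter>\<C> \<in> X" by (auto simp: X_def)
      then show ?thesis by blast
    qed
  qed
  then obtain Q where "Q \<in> X" "\<forall>A\<in>X. A \<subseteq> Q \<longrightarrow> A = Q" by blast
  then show thesis by (intro that[of Q]) (auto simp: X_def)
qed

subsection \<open>Compact convex sets in products of lines\<close>

text \<open>Coordinatewise convex combination of points in a product of lines. In these terms
  \<open>mix_closed\<close> is convexity and \<open>mix_extreme\<close> is being an extreme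
  point.\<close>

definition mix :: "real \<Rightarrow> ('i \<Rightarrow> real) \<Rightarrow> ('i \<Rightarrow> real) \<Rightarrow> 'i \<Rightarrow> real" where
  "mix t p q = (\<lambda>i. (1 - t) * p i + t * q i)"

definition mix_closed :: "('i \<Rightarrow> real) set \<Rightarrow> bool" where
  "mix_closed Q \<longleftrightarrow> (\<forall>p\<in>Q. \<forall>q\<in>Q. \<forall>t\<in>{0..1}. mix t p q \<in> Q)"

definition mix_extreme :: "('i \<Rightarrow> real) \<Rightarrow> ('i \<Rightarrow> real) set \<Rightarrow> bool" where
  "mix_extreme x Q \<longleftrightarrow> x \<in> Q \<and>
     (\<forall>p\<in>Q. \<forall>q\<in>Q. \<forall>t. 0 < t \<and> t < 1 \<and> mix t p q = x \<longrightarrow> p = x \<and> q = x)"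

lemma mix_extremeD:
  assumes "mix_extreme x Q" "p \<in> Q" "q \<in> Q" "0 < t \<and> t < 1" "mix t p q = x"
  shows "p = x"
  using assms unfolding mix_extreme_def by blast

lemma continuous_on_coord [continuous_intros]:
  "continuous_on S (\<lambda>x :: 'i \<Rightarrow> 'b::topological_space. x i)"
  by (rule continuous_on_subset[OF continuous_on_product_coordinates subset_UNIV])

text \<open>The existence part of Krein-Milman: on a minimal closed face every coordinate is
  constant, since the points where a coordinate is maximal form a closed subface. So the face is a
  single point, and this point is extreme.\<close>

lemma exists_mix_extreme:
  assumes "compact Q" "Q \<noteq> {}"
  shows "\<exists>x. mix_extreme x Q"
proof -
  define face where "face F \<longleftrightarrow>
    (\<forall>p\<in>Q. \<forall>q\<in>Q. \<forall>t. 0 < t \<and> t < 1 \<and> mix t p q \<in> F \<longrightarrow> p \<in> F \<and> q \<in> F)" for F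
  obtain F where F: "F \<subseteq> Q" "closed F" "F \<noteq> {}" "face F"
    and min: "\<And>A. A \<subseteq> F \<Longrightarrow> closed A \<Longrightarrow> A \<noteq> {} \<Longrightarrow> face A \<Longrightarrow> A = F"
  proof (rule minimal_nonempty_closed_subset[of Q face])
    show "face Q" by (auto simp: face_def)
    show "face (\<Inter>\<C>)" if "\<C> \<noteq> {}" "\<And>A. A \<in> \<C> \<Longrightarrow> face A" for \<C>
      using that unfolding face_def by blast
  qed (use assms compact_fun_imp_closed in auto)
  have "compact F" using compact_Int_closed[OF assms(1) F(2)] F(1) by (simp add: Int_absorb1)
  have le: "q i \<le> p i" if "p \<in> F" "q \<in> F" for p q i
  proof -
    have "continuous_on F (\<lambda>q. q i)" by (intro continuous_intros)
    then obtain m where m: "m \<in> F" "\<And>q. q \<in> F \<Longrightarrow> q i \<le> m i"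
      using continuous_attains_sup[OF \<open>compact F\<close> \<open>F \<noteq> {}\<close>] by metis
    define A where "A = {q \<in> F. m i \<le> q i}"
    have "closed A"
      unfolding A_def Collect_conj_eq using \<open>closed F\<close>
      by (auto intro!: closed_Int closed_Collect_le continuous_intros)
    have "face A"
      unfolding face_def
    proof (intro ballI allI impI)
      fix p q t assume pq: "p \<in> Q" "q \<in> Q" and t: "0 < t \<and> t < 1 \<and> mix t p q \<in> A"
      then have F': "p \<in> F" "q \<in> F" using F(4) by (auto simp: face_def A_def)
      have a: "m i \<le> (1 - t) * p i + t * q i" using t by (auto simp: A_def mix_def)
      have b: "(1 - t) * p i \<le> (1 - t) * m i" "t * q i \<le> t * m i"
        using m(2) F' t by (auto intro!: mult_left_mono)
      \<comment> \<open>Both summands are bounded above, and their sum reaches the sum of the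
        bounds, so each bound is attained.\<close>
      have "(1 - t) * m i \<le> (1 - t) * p i" "t * m i \<le> t * q i"
        using a b by (auto simp: algebra_simps)
      with t F' show "p \<in> A \<and> q \<in> A" by (auto simp: A_def)
    qed
    then have "A = F" using m \<open>closed A\<close> by (intro min) (auto simp: A_def)
    then show ?thesis using m that by (auto simp: A_def) (metis (mono_tags, lifting) mem_Collect_eq order_trans)
  qed
  obtain x where "x \<in> F" using F by blast
  then have "F = {x}" using le by (auto intro!: ext antisym)
  then show ?thesis using F by (auto simp: mix_extreme_def face_def)
qed

text \<open>\<open>J\<close> is the union of all segments from \<open>A\<close> to \<open>B\<close>,
  which is the convex hull of \<open>A \<union> B\<close> because both sets are convex. It is
  compact as a continuous image of a compact product.\<close>

lemma mix_join:
  fixes A B :: "('i \<Rightarrow> real) set"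
  assumes "compact A" "mix_closed A" "compact B" "mix_closed B" "A \<noteq> {}" "B \<noteq> {}"
  defines "J \<equiv> (\<lambda>(t, p, q). mix t p q) ` ({0..1} \<times> A \<times> B)"
  shows "compact J" "mix_closed J" "A \<subseteq> J" "B \<subseteq> J"
proof -
  have "continuous_on ({0..1} \<times> A \<times> B) (\<lambda>(t, p, q). mix t p q)"
    unfolding mix_def case_prod_beta
    by (intro continuous_intros
        continuous_on_product_then_coordinatewise[where f = "\<lambda>z. fst (snd z)"]
        continuous_on_product_then_coordinatewise[where f = "\<lambda>z. snd (snd z)"])
  then show "compact J"
    unfolding J_def using assms by (intro compact_continuous_image compact_Times) auto
  have "mix 0 p q = p" "mix 1 p q = q" for p q :: "'i \<Rightarrow> real" by (auto simp: mix_def)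
  moreover have "mix t p q \<in> J" if "t \<in> {0..1}" "p \<in> A" "q \<in> B" for t p q
    unfolding J_def by (rule image_eqI[of _ _ "(t, p, q)"]) (use that in auto)
  ultimately show "A \<subseteq> J" "B \<subseteq> J"
    using assms(5,6) by (metis atLeastAtMost_iff equals0I order_refl subsetI zero_le_one)+
  show "mix_closed J"
    unfolding mix_closed_def
  proof (intro ballI)
    fix x y and t :: real assume "x \<in> J" "y \<in> J" and t: "t \<in> {0..1}"
    then obtain a p q b p' q' where *: "a \<in> {0..1}" "p \<in> A" "q \<in> B" "x = mix a p q"
      "b \<in> {0..1}" "p' \<in> A" "q' \<in> B" "y = mix b p' q'"
      by (auto simp: J_def)
    \<comment> \<open>\<open>c\<close> is the total weight that \<open>mix t x y\<close> gives to
      points of \<open>B\<close>. Normalizing the \<open>A\<close> part and the \<open>B\<close>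
      part separately gives \<open>r\<close> and \<open>s\<close> below.\<close>
    define c where "c = (1 - t) * a + t * b"
    have c1: "1 - c = (1 - t) * (1 - a) + t * (1 - b)" by (simp add: c_def algebra_simps)
    have "0 \<le> c" using * t by (auto simp: c_def)
    moreover have "0 \<le> 1 - c" unfolding c1 using * t by auto
    ultimately have c: "c \<in> {0..1}" by auto
    \<comment> \<open>For \<open>c = 1\<close> or \<open>c = 0\<close> one of the quotients below is \<open>0 / 0 = 0\<close>,
      with a factor \<open>1 - c\<close> or \<open>c\<close> in front of the corresponding mixture.\<close>
    define r where "r = mix (t * (1 - b) / (1 - c)) p p'"
    define s where "s = mix (t * b / c) q q'"
    have nonneg: "0 \<le> (1 - t) * (1 - a)" "0 \<le> t * (1 - b)" "0 \<le> (1 - t) * a" "0 \<le> t * b"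
      using * t by auto
    then have "t * (1 - b) \<le> 1 - c" "t * b \<le> c"
      unfolding c1 by (auto simp: c_def)
    then have "t * (1 - b) / (1 - c) \<in> {0..1}" "t * b / c \<in> {0..1}"
      using nonneg c unfolding atLeastAtMost_iff
      by (auto intro!: divide_nonneg_nonneg simp: divide_le_eq_1)
    then have rs: "r \<in> A" "s \<in> B" using * assms(2,4) by (auto simp: r_def s_def mix_closed_def)
    \<comment> \<open>Clears the denominator also when \<open>k = 0\<close>: then
      \<open>d = 0\<close> and both sides vanish.\<close>
    have scale: "k * mix (d / k) f g i = (k - d) * f i + d * g i"
      if "k = 0 \<Longrightarrow> d = 0" for k d i and f g :: "'i \<Rightarrow> real"
    proof -
      have "k * (d / k) = d" using that by auto
      moreover have "k * mix (d / k) f g i = (k - k * (d / k)) * f i + k * (d / k) * g i"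
        unfolding mix_def by (simp only: algebra_simps)
      ultimately show ?thesis by simp
    qed
    have r: "(1 - c) * r i = (1 - t) * (1 - a) * p i + t * (1 - b) * p' i" for i
      unfolding r_def by (subst scale) (use nonneg c1 in linarith, simp add: c1)
    have s: "c * s i = (1 - t) * a * q i + t * b * q' i" for i
      unfolding s_def by (subst scale) (use nonneg c_def in linarith, simp add: c_def)
    have "mix t x y = mix c r s"
    proof
      fix i
      show "mix t x y i = mix c r s i"
        unfolding mix_def[of c] r s *(4,8) mix_def by (simp only: algebra_simps)
    qed
    then show "mix t x y \<in> J" using rs c by (force simp: J_def)
  qed
qed

text \<open>\<open>J\<close> arises by joining the sets one at a time. An extreme point of
  \<open>Q\<close> cannot lie strictly inside a segment of \<open>Q\<close> with an endpoint
  different from it, so at each join it already belongs to one of the two pieces.\<close>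

lemma mix_join_finite:
  fixes C :: "'k \<Rightarrow> ('i \<Rightarrow> real) set"
  assumes "finite S" "\<And>s. s \<in> S \<Longrightarrow> compact (C s) \<and> mix_closed (C s) \<and> C s \<subseteq> Q" "mix_closed Q"
  shows "\<exists>J\<subseteq>Q. compact J \<and> mix_closed J \<and> (\<Union>s\<in>S. C s) \<subseteq> J \<and>
           (\<forall>x\<in>J. mix_extreme x Q \<longrightarrow> x \<in> (\<Union>s\<in>S. C s))"
  using assms(1,2)
proof (induction S)
  case empty
  then show ?case by (intro exI[of _ "{}"]) (auto simp: mix_closed_def)
next
  case (insert s S)
  then obtain J where J: "J \<subseteq> Q" "compact J" "mix_closed J" "(\<Union>s\<in>S. C s) \<subseteq> J"
    "\<forall>x\<in>J. mix_extreme x Q \<longrightarrow> x \<in> (\<Union>s\<in>S. C s)" by auto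
  have C: "compact (C s)" "mix_closed (C s)" "C s \<subseteq> Q" using insert.prems by auto
  \<comment> \<open>The join with an empty set is empty and would lose the other piece.\<close>
  consider "J = {}" | "C s = {}" | "J \<noteq> {}" "C s \<noteq> {}" by blast
  then show ?case
  proof cases
    case 1
    with C J show ?thesis by (intro exI[of _ "C s"]) auto
  next
    case 2
    with J show ?thesis by (intro exI[of _ J]) auto
  next
    case 3
    define J' where "J' = (\<lambda>(t, p, q). mix t p q) ` ({0..1} \<times> J \<times> C s)"
    note J' = mix_join[OF J(2,3) C(1,2) 3, folded J'_def]
    have "J' \<subseteq> Q" using J(1) C(3) assms(3) by (fastforce simp: J'_def mix_closed_def)
    moreover have "x \<in> (\<Union>s\<in>insert s S. C s)" if "x \<in> J'" and ext: "mix_extreme x Q" for x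
    proof -
      obtain t p q where *: "t \<in> {0..1}" "p \<in> J" "q \<in> C s" "x = mix t p q"
        using \<open>x \<in> J'\<close> by (auto simp: J'_def)
      have pq: "p \<in> Q" "q \<in> Q" using * J(1) C(3) by auto
      consider "t = 0" | "t = 1" | "0 < t \<and> t < 1" using *(1) by fastforce
      then have "x = p \<or> x = q"
      proof cases
        case 3
        then show ?thesis using mix_extremeD[OF ext pq 3 *(4)[symmetric]] by simp
      next
        case 1
        then show ?thesis by (simp add: *(4) mix_def)
      next
        case 2
        then show ?thesis by (simp add: *(4) mix_def)
      qed
      then show ?thesis using *(2,3) J(5) ext by blast
    qed
    moreover have "(\<Union>s\<in>insert s S. C s) \<subseteq> J'" using J'(3,4) J(4) by auto
    ultimately show ?thesis using J'(1,2) by blast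
  qed
qed

subsection \<open>Means on bounded functions\<close>

text \<open>\<open>left_invariant_mean\<close> stripped of its invariance clause, so that the group
  can act on the remaining objects.\<close>

definition is_mean :: "('a, 'b) monoid_scheme \<Rightarrow> (('a \<Rightarrow> real) \<Rightarrow> real) \<Rightarrow> bool" where
  "is_mean G m \<longleftrightarrow>
     (\<forall>f\<in>bounded_functions G. \<forall>h\<in>bounded_functions G. m (\<lambda>x. f x + h x) = m f + m h) \<and>
     (\<forall>c. \<forall>f\<in>bounded_functions G. m (\<lambda>x. c * f x) = c * m f) \<and>
     (\<forall>f\<in>bounded_functions G. (\<forall>x\<in>carrier G. 0 \<le> f x) \<longrightarrow> 0 \<le> m f) \<and>
     m (\<lambda>_. 1) = 1"

lemma left_invariant_mean_iff:
  "left_invariant_mean G m \<longleftrightarrow> is_mean G m \<and>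
     (\<forall>a\<in>carrier G. \<forall>f\<in>bounded_functions G. m (\<lambda>x. f (a \<otimes>\<^bsub>G\<^esub> x)) = m f)"
  by (auto simp: left_invariant_mean_def is_mean_def)

lemma bounded_functionsI: "(\<And>x. x \<in> carrier G \<Longrightarrow> \<bar>f x\<bar> \<le> C) \<Longrightarrow> f \<in> bounded_functions G"
  by (auto simp: bounded_functions_def)

lemma bounded_functionsE:
  assumes "f \<in> bounded_functions G"
  obtains C where "\<And>x. x \<in> carrier G \<Longrightarrow> \<bar>f x\<bar> \<le> C"
  using assms by (auto simp: bounded_functions_def)

lemma bounded_functions_const: "(\<lambda>_. c) \<in> bounded_functions G"
  by (rule bounded_functionsI[of _ _ "\<bar>c\<bar>"]) simp

lemma bounded_functions_add:
  assumes "f \<in> bounded_functions G" "h \<in> bounded_functions G"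
  shows "(\<lambda>x. f x + h x) \<in> bounded_functions G"
proof -
  obtain C D where "\<And>x. x \<in> carrier G \<Longrightarrow> \<bar>f x\<bar> \<le> C" "\<And>x. x \<in> carrier G \<Longrightarrow> \<bar>h x\<bar> \<le> D"
    using assms bounded_functionsE by metis
  then show ?thesis by (intro bounded_functionsI[of _ _ "C + D"]) (smt (verit))
qed

lemma bounded_functions_cmult:
  assumes "f \<in> bounded_functions G"
  shows "(\<lambda>x. c * f x) \<in> bounded_functions G"
proof -
  obtain C where "\<And>x. x \<in> carrier G \<Longrightarrow> \<bar>f x\<bar> \<le> C"
    using assms bounded_functionsE by metis
  then show ?thesis
    by (intro bounded_functionsI[of _ _ "\<bar>c\<bar> * C"]) (simp add: abs_mult mult_left_mono)
qed

lemma bounded_functions_sum: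
  assumes "\<And>i. i \<in> F \<Longrightarrow> f i \<in> bounded_functions G"
  shows "(\<lambda>x. \<Sum>i\<in>F. f i x) \<in> bounded_functions G"
  using assms
  by (induction F rule: infinite_finite_induct)
    (simp_all add: bounded_functions_const bounded_functions_add)

lemma bounded_functions_cong:
  assumes "\<And>x. x \<in> carrier G \<Longrightarrow> f x = h x"
  shows "f \<in> bounded_functions G \<longleftrightarrow> h \<in> bounded_functions G"
  using assms by (simp add: bounded_functions_def)

lemma mean_add:
  "is_mean G m \<Longrightarrow> f \<in> bounded_functions G \<Longrightarrow> h \<in> bounded_functions G \<Longrightarrow>
    m (\<lambda>x. f x + h x) = m f + m h"
  by (simp add: is_mean_def)

lemma mean_cmult:
  "is_mean G m \<Longrightarrow> f \<in> bounded_functions G \<Longrightarrow> m (\<lambda>x. c * f x) = c * m f"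
  by (simp add: is_mean_def)

lemma mean_const:
  assumes "is_mean G m"
  shows "m (\<lambda>_. c) = c"
  using mean_cmult[OF assms bounded_functions_const[of 1], of c] assms by (simp add: is_mean_def)

lemma mean_mono:
  assumes m: "is_mean G m" and B: "f \<in> bounded_functions G" "h \<in> bounded_functions G"
    and le: "\<And>x. x \<in> carrier G \<Longrightarrow> f x \<le> h x"
  shows "m f \<le> m h"
proof -
  have "(\<lambda>x. h x + (- 1) * f x) \<in> bounded_functions G"
    using B by (intro bounded_functions_add bounded_functions_cmult)
  then have "0 \<le> m (\<lambda>x. h x + (- 1) * f x)"
    using m le by (simp add: is_mean_def)
  also have "\<dots> = m h + (- 1) * m f"
    unfolding mean_add[OF m B(2) bounded_functions_cmult[OF B(1)]] mean_cmult[OF m B(1)] ..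
  finally show ?thesis by simp
qed

lemma mean_cong:
  assumes "is_mean G m" "f \<in> bounded_functions G" "\<And>x. x \<in> carrier G \<Longrightarrow> f x = h x"
  shows "m f = m h"
proof -
  have "h \<in> bounded_functions G" using assms bounded_functions_cong by metis
  then show ?thesis using assms mean_mono[of G m f h] mean_mono[of G m h f] by simp
qed

lemma mean_sum:
  assumes "is_mean G m" "\<And>i. i \<in> F \<Longrightarrow> f i \<in> bounded_functions G"
  shows "m (\<lambda>x. \<Sum>i\<in>F. f i x) = (\<Sum>i\<in>F. m (f i))"
  using assms(2)
  by (induction F rule: infinite_finite_induct)
    (simp_all add: mean_const[OF assms(1)] mean_add[OF assms(1)] bounded_functions_sum)

lemma mean_abs_le:
  assumes "is_mean G m" "\<And>x. x \<in> carrier G \<Longrightarrow> \<bar>f x\<bar> \<le> C"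
  shows "\<bar>m f\<bar> \<le> C"
proof -
  have B: "f \<in> bounded_functions G" using assms(2) by (rule bounded_functionsI)
  have "f x \<le> C" "- C \<le> f x" if "x \<in> carrier G" for x using assms(2)[OF that] by auto
  then have "m f \<le> m (\<lambda>_. C)" "m (\<lambda>_. - C) \<le> m f"
    by (auto intro!: mean_mono[OF assms(1)] B bounded_functions_const)
  then show ?thesis by (simp add: mean_const[OF assms(1)])
qed

section \<open>Nearest points and barycenters in compact convex sets\<close>

lemma compact_coord_bounded:
  fixes Q :: "('i \<Rightarrow> real) set"
  assumes "compact Q"
  obtains C where "\<And>q. q \<in> Q \<Longrightarrow> \<bar>q i\<bar> \<le> C"
proof -
  have "compact ((\<lambda>q. q i) ` Q)"
    using assms by (intro compact_continuous_image continuous_intros)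
  then show thesis
    using that compact_imp_bounded by (metis bounded_real imageI)
qed

text \<open>Take \<open>u\<close> minimizing the squared distance to \<open>p\<close> in the
  coordinates \<open>F\<close>. If the angle condition failed for some \<open>q\<close>, a short
  move from \<open>u\<close> towards \<open>q\<close> would decrease this distance.\<close>

lemma nearest_point_obtuse:
  fixes Q :: "('i \<Rightarrow> real) set"
  assumes "compact Q" "mix_closed Q" "Q \<noteq> {}"
  shows "\<exists>u\<in>Q. \<forall>q\<in>Q. 0 \<le> (\<Sum>i\<in>F. (u i - p i) * (q i - u i))"
proof -
  have "continuous_on Q (\<lambda>q. \<Sum>i\<in>F. (q i - p i)\<^sup>2)"
    by (intro continuous_intros)
  from continuous_attains_inf[OF assms(1,3) this]
  obtain u where u: "u \<in> Q" "\<And>q. q \<in> Q \<Longrightarrow> (\<Sum>i\<in>F. (u i - p i)\<^sup>2) \<le> (\<Sum>i\<in>F. (q i - p i)\<^sup>2)"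
    by blast
  have "0 \<le> (\<Sum>i\<in>F. (u i - p i) * (q i - u i))" if "q \<in> Q" for q
  proof (rule ccontr)
    define a where "a = (\<Sum>i\<in>F. (u i - p i) * (q i - u i))"
    define b where "b = (\<Sum>i\<in>F. (q i - u i)\<^sup>2)"
    assume "\<not> 0 \<le> (\<Sum>i\<in>F. (u i - p i) * (q i - u i))"
    then have "a < 0" by (simp add: a_def)
    have "0 \<le> b" unfolding b_def by (intro sum_nonneg) auto
    \<comment> \<open>The distance changes by \<open>t * (2 * a + t * b)\<close>. This
      \<open>t\<close> makes \<open>t * b < - a\<close>, so the change is negative; the
      \<open>+ 1\<close> keeps the denominator positive.\<close>
    define t where "t = min 1 (- a / (b + 1))"
    have t: "0 < t" "t \<le> 1" "t \<le> - a / (b + 1)"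
      using \<open>a < 0\<close> \<open>0 \<le> b\<close> by (auto simp: t_def divide_neg_pos)
    have ta: "t * (b + 1) \<le> - a"
      using iffD1[OF pos_le_divide_eq, OF _ t(3)] \<open>0 \<le> b\<close> by simp
    have "mix t u q \<in> Q" using assms(2) u that t by (auto simp: mix_closed_def)
    then have "0 \<le> (\<Sum>i\<in>F. (mix t u q i - p i)\<^sup>2) - (\<Sum>i\<in>F. (u i - p i)\<^sup>2)"
      using u(2) by simp
    also have "\<dots> = (\<Sum>i\<in>F. (2 * t) * ((u i - p i) * (q i - u i)) + t\<^sup>2 * (q i - u i)\<^sup>2)"
      unfolding sum_subtractf[symmetric]
      by (intro sum.cong refl) (simp add: mix_def power2_eq_square algebra_simps)
    also have "\<dots> = (2 * t) * a + t\<^sup>2 * b"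
      unfolding a_def b_def sum.distrib sum_distrib_left[symmetric] ..
    also have "\<dots> = t * (2 * a + t * b)" by (simp add: power2_eq_square algebra_simps)
    finally have "0 \<le> 2 * a + t * b" using t by (simp add: zero_le_mult_iff)
    then show False using t ta \<open>a < 0\<close> by (simp add: algebra_simps)
  qed
  with u(1) show ?thesis by blast
qed

text \<open>
  If \<open>u\<close> is the point of \<open>Q\<close> nearest to the barycenter \<open>p\<close> in finitely many coordinates, then
  integrating the obtuse angle condition shows \<open>u = p\<close> there; this avoids Hahn-Banach.
\<close>

lemma mean_barycenter_mem:
  fixes \<phi> :: "'a \<Rightarrow> 'i \<Rightarrow> real"
  assumes m: "is_mean K m" and Q: "compact Q" "mix_closed Q" "Q \<noteq> {}"
    and \<phi>: "\<And>k. k \<in> carrier K \<Longrightarrow> \<phi> k \<in> Q"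
  shows "(\<lambda>i. m (\<lambda>k. \<phi> k i)) \<in> Q"
proof -
  define p where "p = (\<lambda>i. m (\<lambda>k. \<phi> k i))"
  have B: "(\<lambda>k. \<phi> k i) \<in> bounded_functions K" for i
    using compact_coord_bounded[OF Q(1)] \<phi> by (metis bounded_functionsI)
  have "\<exists>u\<in>Q. \<forall>i\<in>F. u i = p i" if "finite F" for F
  proof -
    obtain u where u: "u \<in> Q" "\<And>q. q \<in> Q \<Longrightarrow> 0 \<le> (\<Sum>i\<in>F. (u i - p i) * (q i - u i))"
      using nearest_point_obtuse[OF Q] by metis
    define c where "c = (\<Sum>i\<in>F. (u i - p i) * u i)"
    have "c = m (\<lambda>_. c)" by (simp add: mean_const[OF m])
    also have "\<dots> \<le> m (\<lambda>k. \<Sum>i\<in>F. (u i - p i) * \<phi> k i)"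
      using u(2)[OF \<phi>]
      by (intro mean_mono[OF m] bounded_functions_const bounded_functions_sum bounded_functions_cmult B)
        (simp add: c_def right_diff_distrib sum_subtractf)
    also have "\<dots> = (\<Sum>i\<in>F. (u i - p i) * p i)"
      by (simp add: mean_sum[OF m] bounded_functions_cmult B mean_cmult[OF m] p_def)
    finally have "(\<Sum>i\<in>F. (u i - p i)\<^sup>2) \<le> 0"
      by (simp add: c_def power2_eq_square right_diff_distrib sum_subtractf)
    then have "(\<Sum>i\<in>F. (u i - p i)\<^sup>2) = 0" by (intro antisym sum_nonneg) auto
    with u(1) that show ?thesis by (auto simp: sum_nonneg_eq_0_iff)
  qed
  \<comment> \<open>Agreement with \<open>p\<close> on every finite set of coordinates passes to all
    coordinates at once by compactness of \<open>Q\<close>.\<close>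
  then have fip: "Q \<inter> (\<Inter>i\<in>F. {q. q i = p i}) \<noteq> {}" if "finite F" for F
    using that by blast
  have "closed {q :: 'i \<Rightarrow> real. q i = p i}" for i
    by (rule closed_Collect_eq[OF continuous_on_product_coordinates continuous_on_const])
  then have "Q \<inter> (\<Inter>i\<in>UNIV. {q. q i = p i}) \<noteq> {}"
    by (rule compact_imp_fip_image[OF Q(1)]) (rule fip)
  then obtain u where "u \<in> Q" "\<And>i. u i = p i" by blast
  then have "u = p" by (intro ext)
  with \<open>u \<in> Q\<close> show ?thesis by (simp add: p_def)
qed

text \<open>The value \<open>0\<close> on unbounded functions is a convention that makes the set of means compact.\<close>

definition means :: "('a, 'b) monoid_scheme \<Rightarrow> (('a \<Rightarrow> real) \<Rightarrow> real) set" where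
  "means G = {m. is_mean G m \<and> (\<forall>f. f \<notin> bounded_functions G \<longrightarrow> m f = 0)}"

section \<open>Convexity and compactness of the set of means\<close>

lemma mix_closed_means: "mix_closed (means G)"
  unfolding mix_closed_def
proof (intro ballI)
  fix p q and t :: real assume pq: "p \<in> means G" "q \<in> means G" and t: "t \<in> {0..1}"
  then have m: "is_mean G p" "is_mean G q" by (simp_all add: means_def)
  have "is_mean G (mix t p q)"
    unfolding is_mean_def mix_def
  proof (intro conjI ballI allI impI)
    fix f h assume "f \<in> bounded_functions G" "h \<in> bounded_functions G"
    then show "(1 - t) * p (\<lambda>x. f x + h x) + t * q (\<lambda>x. f x + h x) =
        (1 - t) * p f + t * q f + ((1 - t) * p h + t * q h)"
      by (simp add: mean_add[OF m(1)] mean_add[OF m(2)] distrib_left)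
  next
    fix c f assume "f \<in> bounded_functions G"
    then show "(1 - t) * p (\<lambda>x. c * f x) + t * q (\<lambda>x. c * f x) = c * ((1 - t) * p f + t * q f)"
      by (simp add: mean_cmult[OF m(1)] mean_cmult[OF m(2)] distrib_left)
  next
    fix f assume "f \<in> bounded_functions G" "\<forall>x\<in>carrier G. 0 \<le> f x"
    then have "0 \<le> p f" "0 \<le> q f" using m by (auto simp: is_mean_def)
    then show "0 \<le> (1 - t) * p f + t * q f" using t by simp
  qed (simp add: mean_const[OF m(1)] mean_const[OF m(2)])
  then show "mix t p q \<in> means G" using pq by (simp add: means_def mix_def)
qed

text \<open>Evaluation at a fixed function is continuous for the product topology, so every clause
  of the definition cuts out a closed set.\<close>

lemma closed_means: "closed (means G)"
proof -
  let ?B = "bounded_functions G"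
  have eq: "means G =
    (\<Inter>f\<in>?B. \<Inter>h\<in>?B. {m. m (\<lambda>x. f x + h x) = m f + m h}) \<inter>
    (\<Inter>c. \<Inter>f\<in>?B. {m. m (\<lambda>x. c * f x) = c * m f}) \<inter>
    (\<Inter>f\<in>{f \<in> ?B. \<forall>x\<in>carrier G. 0 \<le> f x}. {m. 0 \<le> m f}) \<inter>
    {m. m (\<lambda>_. 1) = 1} \<inter> (\<Inter>f\<in>- ?B. {m. m f = 0})"
    unfolding means_def is_mean_def
    by (rule Set.set_eqI) (simp only: mem_Collect_eq Int_iff INT_iff Compl_iff Ball_def imp_conjL
      UNIV_I simp_thms conj_assoc)
  have cont: "continuous_on UNIV (\<lambda>m :: ('a \<Rightarrow> real) \<Rightarrow> real. m f)" for f
    by (rule continuous_on_product_coordinates)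
  show ?thesis
    unfolding eq
    by (intro closed_Int closed_INT ballI closed_Collect_eq closed_Collect_le
        continuous_on_add continuous_on_mult_left continuous_on_const cont)
qed

text \<open>Tychonoff, as in Banach-Alaoglu: the value at a bounded \<open>f\<close> stays within
  the bound of \<open>f\<close>, and at an unbounded \<open>f\<close> it is 0. The means are thus a
  closed subset of a product of compact intervals.\<close>

lemma compact_means: "compact (means G)"
proof -
  have "\<exists>C. \<forall>m\<in>means G. \<bar>m f\<bar> \<le> C" for f
  proof (cases "f \<in> bounded_functions G")
    case True
    then obtain C where "\<And>x. x \<in> carrier G \<Longrightarrow> \<bar>f x\<bar> \<le> C" using bounded_functionsE by blast
    then show ?thesis by (intro exI[of _ C]) (auto simp: means_def intro: mean_abs_le)
  qed (auto simp: means_def)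
  then obtain C where C: "\<And>f m. m \<in> means G \<Longrightarrow> \<bar>m f\<bar> \<le> C f" by metis
  have "compact (PiE UNIV (\<lambda>f. {- C f..C f}))"
    using compactin_PiE[of "\<lambda>_. euclidean" UNIV "\<lambda>f. {- C f..C f}"]
    by (simp add: euclidean_product_topology)
  moreover have "means G \<subseteq> PiE UNIV (\<lambda>f. {- C f..C f})"
    using C by (force simp: abs_le_iff)
  ultimately show ?thesis
    using compact_Int_closed[OF _ closed_means] by (metis inf.absorb_iff2)
qed

subsection \<open>The action of a group on its means\<close>

text \<open>The push-forward of \<open>m\<close> under left multiplication by \<open>g\<close>,
  hence a left action on means.\<close>

definition translate :: "('a, 'b) monoid_scheme \<Rightarrow> 'a \<Rightarrow> (('a \<Rightarrow> real) \<Rightarrow> real) \<Rightarrow> ('a \<Rightarrow> real) \<Rightarrow> real"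
  where "translate G g m = (\<lambda>f. m (\<lambda>x. f (g \<otimes>\<^bsub>G\<^esub> x)))"

lemma continuous_on_translate: "continuous_on S (translate G g)"
  unfolding translate_def
  by (intro continuous_on_coordinatewise_then_product
      continuous_on_coord)

lemma translate_mix: "translate G g (mix t p q) = mix t (translate G g p) (translate G g q)"
  by (simp add: translate_def mix_def)

context group
begin

lemma means_nonempty: "means G \<noteq> {}"
proof -
  \<comment> \<open>The point mass at the identity.\<close>
  have "(\<lambda>f. if f \<in> bounded_functions G then f \<one> else 0) \<in> means G"
    by (auto simp: means_def is_mean_def bounded_functions_add bounded_functions_cmult
        bounded_functions_const)
  then show ?thesis by blast
qed

lemma bounded_functions_translate:
  assumes "g \<in> carrier G"
  shows "(\<lambda>x. f (g \<otimes> x)) \<in> bounded_functions G \<longleftrightarrow> f \<in> bounded_functions G"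
proof
  assume "(\<lambda>x. f (g \<otimes> x)) \<in> bounded_functions G"
  then obtain C where C: "\<And>x. x \<in> carrier G \<Longrightarrow> \<bar>f (g \<otimes> x)\<bar> \<le> C" using bounded_functionsE by blast
  show "f \<in> bounded_functions G"
  proof (rule bounded_functionsI)
    fix x assume "x \<in> carrier G"
    then show "\<bar>f x\<bar> \<le> C"
      using C[of "inv g \<otimes> x"] assms by (simp add: m_assoc[symmetric])
  qed
next
  assume "f \<in> bounded_functions G"
  then show "(\<lambda>x. f (g \<otimes> x)) \<in> bounded_functions G"
    using assms by (auto simp: bounded_functions_def)
qed

lemma translate_means:
  assumes "g \<in> carrier G" "m \<in> means G"
  shows "translate G g m \<in> means G"
  using assms bounded_functions_translate[OF assms(1)]
  by (auto simp: means_def is_mean_def translate_def)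

text \<open>Two functions agreeing on the carrier are bounded together or unbounded together; in the
  second case both values are 0. This turns group laws on the carrier into equalities of
  functionals.\<close>

lemma means_cong:
  assumes "m \<in> means G" "\<And>x. x \<in> carrier G \<Longrightarrow> f x = h x"
  shows "m f = m h"
proof (cases "f \<in> bounded_functions G")
  case True
  then show ?thesis using assms mean_cong[of G m f h] by (simp add: means_def)
next
  case False
  then show ?thesis using assms bounded_functions_cong[of G f h] by (auto simp: means_def)
qed

lemma translate_one:
  assumes "m \<in> means G"
  shows "translate G \<one> m = m"
  unfolding translate_def by (intro ext means_cong[OF assms]) simp

lemma translate_mult:
  assumes "m \<in> means G" "g \<in> carrier G" "h \<in> carrier G"
  shows "translate G (g \<otimes> h) m = translate G g (translate G h m)"
  unfolding translate_def using assms(2,3) by (intro ext means_cong[OF assms(1)]) (simp add: m_assoc)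

definition stabilizer :: "(('a \<Rightarrow> real) \<Rightarrow> real) \<Rightarrow> 'a set" where
  "stabilizer m = {g \<in> carrier G. translate G g m = m}"

lemma translate_inv_eqI:
  assumes "m \<in> means G" "g \<in> carrier G" "translate G g m = n"
  shows "translate G (inv g) n = m"
  using assms translate_mult[of m "inv g" g] by (simp add: translate_one)

lemma subgroup_stabilizer:
  assumes "m \<in> means G"
  shows "subgroup (stabilizer m) G"
proof (rule subgroupI)
  show "stabilizer m \<noteq> {}" using translate_one[OF assms] by (auto simp: stabilizer_def)
qed (use assms translate_inv_eqI translate_mult in \<open>auto simp: stabilizer_def\<close>)

text \<open>A function on \<open>H\<close> is pulled back along \<open>\<tau>\<close> and then
  averaged by \<open>m\<close>. Since \<open>H\<close> fixes \<open>m\<close> and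
  \<open>\<tau>\<close> commutes with left multiplication by \<open>H\<close>, the result is left
  invariant.\<close>

lemma amenable_stabilizer:
  assumes m: "m \<in> means G"
  shows "amenable_subgroup (stabilizer m) G"
proof -
  define H where "H = stabilizer m"
  have H: "subgroup H G" unfolding H_def using m by (rule subgroup_stabilizer)
  then have HG: "H \<subseteq> carrier G" by (rule subgroup.subset)
  \<comment> \<open>\<open>r y\<close> depends only on the right coset of \<open>y\<close>, and
    \<open>\<tau> y\<close> is the \<open>H\<close> component in
    \<open>y = \<tau> y \<otimes> r y\<close>.\<close>
  define r where "r y = (SOME z. z \<in> H #> y)" for y
  define \<tau> where "\<tau> y = y \<otimes> inv (r y)" for y
  have r: "r y \<in> H #> y" if "y \<in> carrier G" for y
    unfolding r_def using rcos_self[OF that H] by (rule someI)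
  have \<tau>: "\<tau> y \<in> H" if y: "y \<in> carrier G" for y
  proof -
    obtain h where h: "h \<in> H" "r y = h \<otimes> y" using r[OF y] by (auto simp: r_coset_def)
    then have "h \<in> carrier G" using HG by blast
    then have "\<tau> y = inv h" using h y by (simp add: \<tau>_def inv_mult_group m_assoc[symmetric])
    then show ?thesis using h H by (simp add: subgroup.m_inv_closed)
  qed
  have \<tau>_mult: "\<tau> (h \<otimes> y) = h \<otimes> \<tau> y" if "h \<in> H" "y \<in> carrier G" for h y
  proof -
    have c: "h \<in> carrier G" "r y \<in> carrier G"
      using that HG r r_coset_subset_G[OF HG] by auto
    have "h \<otimes> y \<in> H #> y" using that by (auto simp: r_coset_def)
    then have "H #> y = H #> (h \<otimes> y)" using that H by (intro repr_independence)
    then have "r (h \<otimes> y) = r y" by (simp add: r_def)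
    then show ?thesis using that c by (simp add: \<tau>_def m_assoc)
  qed
  have B: "(\<lambda>y. f (\<tau> y)) \<in> bounded_functions G"
    if "f \<in> bounded_functions (G\<lparr>carrier := H\<rparr>)" for f
    using that \<tau> by (auto simp: bounded_functions_def)
  have "left_invariant_mean (G\<lparr>carrier := H\<rparr>) (\<lambda>f. m (\<lambda>y. f (\<tau> y)))"
    unfolding left_invariant_mean_iff
  proof (intro conjI ballI)
    have "is_mean G m" using m by (simp add: means_def)
    then show "is_mean (G\<lparr>carrier := H\<rparr>) (\<lambda>f. m (\<lambda>y. f (\<tau> y)))"
      using \<tau> by (simp add: is_mean_def B)
  next
    fix a f assume a: "a \<in> carrier (G\<lparr>carrier := H\<rparr>)"
    then have "translate G a m = m" by (simp add: H_def stabilizer_def)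
    from fun_cong[OF this, of "\<lambda>y. f (\<tau> y)"]
    have "m (\<lambda>y. f (\<tau> y)) = m (\<lambda>y. f (\<tau> (a \<otimes> y)))"
      by (simp add: translate_def)
    also have "\<dots> = m (\<lambda>y. f (a \<otimes> \<tau> y))"
      using a by (intro means_cong[OF m]) (simp add: \<tau>_mult)
    finally show "m (\<lambda>y. f (a \<otimes>\<^bsub>G\<lparr>carrier := H\<rparr>\<^esub> \<tau> y)) = m (\<lambda>y. f (\<tau> y))" by simp
  qed
  then show ?thesis
    using H subgroup_imp_group[OF H] by (auto simp: amenable_subgroup_def amenable_def H_def)
qed

text \<open>Averaging the \<open>K\<close>-orbit of any \<open>q\<close> with an invariant mean of
  \<open>K\<close> gives a barycenter in \<open>Q\<close>, and invariance of the mean makes it fixed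
  by \<open>K\<close>.\<close>

lemma amenable_fixed_point:
  assumes K: "amenable_subgroup K G"
    and Q: "Q \<subseteq> means G" "compact Q" "mix_closed Q" "Q \<noteq> {}"
    and inv: "\<And>g q. g \<in> carrier G \<Longrightarrow> q \<in> Q \<Longrightarrow> translate G g q \<in> Q"
  shows "\<exists>p\<in>Q. K \<subseteq> stabilizer p"
proof -
  have KG: "K \<subseteq> carrier G" using K by (auto simp: amenable_subgroup_def dest: subgroup.subset)
  obtain n where n: "is_mean (G\<lparr>carrier := K\<rparr>) n"
    and ninv: "\<And>a f. a \<in> K \<Longrightarrow> f \<in> bounded_functions (G\<lparr>carrier := K\<rparr>) \<Longrightarrow> n (\<lambda>x. f (a \<otimes> x)) = n f"
    using K by (auto simp: amenable_subgroup_def amenable_def left_invariant_mean_iff)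
  obtain q where q: "q \<in> Q" using Q by blast
  then have qm: "q \<in> means G" using Q by blast
  define p where "p = (\<lambda>f. n (\<lambda>k. translate G k q f))"
  have "p \<in> Q"
    unfolding p_def using KG by (intro mean_barycenter_mem[OF n Q(2-4)] inv q) auto
  moreover have "translate G a p = p" if "a \<in> K" for a
  proof
    fix f
    \<comment> \<open>Stated for every \<open>f\<close>, since it is applied both to the given
      function and to its translate by \<open>a\<close>.\<close>
    have B: "(\<lambda>k. translate G k q f) \<in> bounded_functions (G\<lparr>carrier := K\<rparr>)" for f
    proof -
      obtain C where "\<And>u. u \<in> Q \<Longrightarrow> \<bar>u f\<bar> \<le> C"
        using compact_coord_bounded[OF Q(2)] by blast
      then show ?thesis
        using inv[OF _ q] KG by (intro bounded_functionsI[of _ _ C]) auto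
    qed
    have "translate G a p f = n (\<lambda>k. translate G k q (\<lambda>x. f (a \<otimes> x)))"
      by (simp add: translate_def p_def)
    also have "\<dots> = n (\<lambda>k. translate G (a \<otimes> k) q f)"
      using that KG translate_mult[OF qm, of a]
      by (intro mean_cong[OF n B]) (auto simp: translate_def subset_iff fun_eq_iff)
    also have "\<dots> = p f" unfolding p_def by (rule ninv[OF that B])
    finally show "translate G a p f = p f" .
  qed
  ultimately show ?thesis using KG by (auto simp: stabilizer_def)
qed

end

subsection \<open>Extreme points of minimal invariant sets\<close>

lemma mem_conjugate:
  "x \<in> conjugate G K \<gamma> \<longleftrightarrow> (\<exists>k\<in>K. x = inv\<^bsub>G\<^esub> \<gamma> \<otimes>\<^bsub>G\<^esub> k \<otimes>\<^bsub>G\<^esub> \<gamma>)"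
  by (auto simp: conjugate_def l_coset_def r_coset_def)

context group
begin

definition invariant :: "(('a \<Rightarrow> real) \<Rightarrow> real) set \<Rightarrow> bool" where
  "invariant Q \<longleftrightarrow> (\<forall>g\<in>carrier G. \<forall>q\<in>Q. translate G g q \<in> Q)"

lemma exists_minimal_invariant:
  obtains Q where "Q \<subseteq> means G" "compact Q" "Q \<noteq> {}" "mix_closed Q" "invariant Q"
    "\<And>A. A \<subseteq> Q \<Longrightarrow> closed A \<Longrightarrow> A \<noteq> {} \<Longrightarrow> mix_closed A \<Longrightarrow> invariant A \<Longrightarrow> A = Q"
proof -
  obtain Q where Q: "Q \<subseteq> means G" "closed Q" "Q \<noteq> {}" "mix_closed Q \<and> invariant Q"
    and min: "\<And>A. A \<subseteq> Q \<Longrightarrow> closed A \<Longrightarrow> A \<noteq> {} \<Longrightarrow> mix_closed A \<and> invariant A \<Longrightarrow> A = Q"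
  proof (rule minimal_nonempty_closed_subset[of "means G" "\<lambda>A. mix_closed A \<and> invariant A"])
    show "mix_closed (means G) \<and> invariant (means G)"
      by (simp add: mix_closed_means invariant_def translate_means)
    show "mix_closed (\<Inter>\<C>) \<and> invariant (\<Inter>\<C>)"
      if "\<And>A. A \<in> \<C> \<Longrightarrow> mix_closed A \<and> invariant A" for \<C>
      using that unfolding mix_closed_def invariant_def by blast
  qed (use compact_means closed_means means_nonempty in auto)
  have "compact Q"
    using compact_Int_closed[OF compact_means[of G] Q(2)] Q(1) by (simp add: Int_absorb1)
  then show thesis using that[of Q] Q min by blast
qed

text \<open>Translation by \<open>g\<close> is an affine bijection of \<open>Q\<close>, with inverse
  translation by \<open>inv g\<close>.\<close>

lemma mix_extreme_translate:
  assumes Q: "Q \<subseteq> means G" "invariant Q" and g: "g \<in> carrier G" and x: "mix_extreme x Q"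
  shows "mix_extreme (translate G g x) Q"
proof -
  have xQ: "x \<in> Q" using x by (simp add: mix_extreme_def)
  have undo: "q = translate G g (translate G (inv g) q)" if "q \<in> Q" for q
    using that g Q translate_mult[of q g "inv g"] translate_one[of q] by auto
  have "p = translate G g x \<and> q = translate G g x"
    if pq: "p \<in> Q" "q \<in> Q" and t: "0 < t \<and> t < 1" and eq: "mix t p q = translate G g x" for p q t
  proof -
    have "mix t (translate G (inv g) p) (translate G (inv g) q) = x"
      unfolding translate_mix[symmetric] eq
      using g xQ Q by (intro translate_inv_eqI) auto
    moreover have "translate G (inv g) p \<in> Q" "translate G (inv g) q \<in> Q"
      using pq g Q by (auto simp: invariant_def)
    ultimately have "translate G (inv g) p = x" "translate G (inv g) q = x"
      using x t unfolding mix_extreme_def by blast+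
    then show ?thesis using undo pq by metis
  qed
  then show ?thesis using xQ g Q by (auto simp: mix_extreme_def invariant_def)
qed

lemma amenably_visible_meets_stabilizer:
  assumes Q: "Q \<subseteq> means G" "compact Q" "Q \<noteq> {}" "mix_closed Q" "invariant Q"
    and min: "\<And>A. A \<subseteq> Q \<Longrightarrow> closed A \<Longrightarrow> A \<noteq> {} \<Longrightarrow> mix_closed A \<Longrightarrow> invariant A \<Longrightarrow> A = Q"
    and S: "amenably_visible G S" and x: "mix_extreme x Q"
  shows "S \<inter> stabilizer x \<noteq> {}"
proof -
  obtain K where "finite S" and SG: "S \<subseteq> carrier G" and K: "amenable_subgroup K G"
    and hit: "\<And>\<gamma>. \<gamma> \<in> carrier G \<Longrightarrow> S \<inter> conjugate G K \<gamma> \<noteq> {}"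
    using S by (auto simp: amenably_visible_def)
  obtain p where p: "p \<in> Q" "K \<subseteq> stabilizer p"
    using amenable_fixed_point[OF K Q(1,2,4,3)] Q(5) by (auto simp: invariant_def)
  define C where "C s = {q \<in> Q. translate G s q = q}" for s
  have C: "compact (C s) \<and> mix_closed (C s) \<and> C s \<subseteq> Q" for s
  proof (intro conjI)
    have "closed (\<Inter>f. {q. translate G s q f = q f})"
      unfolding translate_def by (intro closed_INT ballI closed_Collect_eq continuous_on_coord)
    moreover have "C s = Q \<inter> (\<Inter>f. {q. translate G s q f = q f})" by (auto simp: C_def)
    ultimately show "compact (C s)" using compact_Int_closed[OF Q(2)] by (simp only:)
    show "mix_closed (C s)" using Q(4) by (auto simp: C_def mix_closed_def translate_mix)
  qed (auto simp: C_def)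
  from mix_join_finite[where C = C, OF \<open>finite S\<close> C Q(4)]
  obtain J where J: "compact J" "mix_closed J" "(\<Union>s\<in>S. C s) \<subseteq> J"
    and JC: "\<forall>x\<in>J. mix_extreme x Q \<longrightarrow> x \<in> (\<Union>s\<in>S. C s)"
    by (elim exE conjE) (rule that)
  \<comment> \<open>\<open>J\<close> need not be invariant; \<open>A\<close> is the largest
    invariant subset of \<open>Q \<inter> J\<close>, to which minimality applies.\<close>
  define A where "A = {q \<in> Q. \<forall>g\<in>carrier G. translate G g q \<in> J}"
  have "A = Q"
  proof (rule min)
    have "closed (translate G g -` J)" for g
      using J(1) by (intro closed_vimage compact_fun_imp_closed continuous_on_translate)
    then have "closed (Q \<inter> (\<Inter>g\<in>carrier G. translate G g -` J))"
      using compact_fun_imp_closed[OF Q(2)] by (intro closed_Int closed_INT ballI)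
    moreover have "A = Q \<inter> (\<Inter>g\<in>carrier G. translate G g -` J)" by (auto simp: A_def)
    ultimately show "closed A" by simp
    show "mix_closed A" using Q(4) J(2) by (auto simp: A_def mix_closed_def translate_mix)
    show "invariant A"
      unfolding invariant_def
    proof (intro ballI)
      fix h q assume h: "h \<in> carrier G" and q: "q \<in> A"
      then have "translate G g (translate G h q) \<in> J" if "g \<in> carrier G" for g
      proof -
        have "translate G (g \<otimes> h) q \<in> J" using that h q by (simp add: A_def)
        moreover have "q \<in> means G" using q Q(1) by (auto simp: A_def)
        ultimately show ?thesis using that h by (simp add: translate_mult)
      qed
      then show "translate G h q \<in> A" using h q Q(5) by (auto simp: A_def invariant_def)
    qed
    have "translate G g p \<in> J" if g: "g \<in> carrier G" for g
    proof -
      \<comment> \<open>Visibility at \<open>inv g\<close> yields an \<open>s\<close> in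
        \<open>S\<close> that is a conjugate of some \<open>k\<close> by \<open>g\<close>; as
        \<open>k\<close> fixes \<open>p\<close>, \<open>s\<close> fixes the translate of
        \<open>p\<close> by \<open>g\<close>.\<close>
      obtain s k where s: "s \<in> S" "k \<in> K" "s = inv (inv g) \<otimes> k \<otimes> inv g"
        using hit[OF inv_closed[OF g]] mem_conjugate[of _ G K "inv g"] by blast
      have k: "k \<in> carrier G" "translate G k p = p" using s p(2) by (auto simp: stabilizer_def)
      have pm: "p \<in> means G" using p(1) Q(1) by blast
      have "s \<otimes> g = g \<otimes> k" using s(3) g k by (simp add: m_assoc)
      then have "translate G s (translate G g p) = translate G g p"
        using translate_mult[OF pm, of s g] translate_mult[OF pm, of g k] g k s(1) SG by auto
      then have "translate G g p \<in> C s" using g p(1) Q(5) by (auto simp: C_def invariant_def)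
      then show ?thesis using s(1) J(3) by blast
    qed
    then show "A \<noteq> {}" using p(1) by (auto simp: A_def)
  qed (auto simp: A_def)
  then have "x \<in> A" using x by (simp add: mix_extreme_def)
  then have "x \<in> J" using Q(1) translate_one[of x] by (auto simp: A_def dest!: bspec[of _ _ \<one>])
  then have "x \<in> (\<Union>s\<in>S. C s)" by (rule mp[OF bspec[OF JC] x])
  then show ?thesis using SG by (auto simp: C_def stabilizer_def)
qed

text \<open>The conjugate of the stabilizer of \<open>x\<close> by \<open>\<gamma>\<close> is the
  stabilizer of the translate of \<open>x\<close> by \<open>inv \<gamma>\<close>, again an extreme
  point of \<open>Q\<close>. So the single stabilizer of \<open>x\<close> handles all
  conjugates.\<close>

lemma exists_amenable_subgroup_meeting_visible:
  "\<exists>H. amenable_subgroup H G \<and>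
     (\<forall>S. amenably_visible G S \<longrightarrow> (\<forall>\<gamma>\<in>carrier G. conjugate G H \<gamma> \<inter> S \<noteq> {}))"
proof -
  obtain Q where Q: "Q \<subseteq> means G" "compact Q" "Q \<noteq> {}" "mix_closed Q" "invariant Q"
    and min: "\<And>A. A \<subseteq> Q \<Longrightarrow> closed A \<Longrightarrow> A \<noteq> {} \<Longrightarrow> mix_closed A \<Longrightarrow> invariant A \<Longrightarrow> A = Q"
    by (rule exists_minimal_invariant) blast
  obtain x where x: "mix_extreme x Q" using exists_mix_extreme[OF Q(2,3)] by blast
  then have xm: "x \<in> means G" using Q(1) by (auto simp: mix_extreme_def)
  have "conjugate G (stabilizer x) \<gamma> \<inter> S \<noteq> {}"
    if S: "amenably_visible G S" and \<gamma>: "\<gamma> \<in> carrier G" for S \<gamma>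
  proof -
    define y where "y = translate G (inv \<gamma>) x"
    have "mix_extreme y Q"
      unfolding y_def using \<gamma> by (intro mix_extreme_translate Q x) simp
    then obtain s where s: "s \<in> S" "s \<in> carrier G" "translate G s y = y"
      using amenably_visible_meets_stabilizer[OF Q min S] by (auto simp: stabilizer_def)
    \<comment> \<open>Conjugating back carries the element \<open>s\<close> fixing \<open>y\<close>
      to an element fixing \<open>x\<close>.\<close>
    define k where "k = \<gamma> \<otimes> s \<otimes> inv \<gamma>"
    have "translate G k x = translate G \<gamma> (translate G s y)"
      using \<gamma> s(2) xm by (simp add: k_def y_def translate_mult translate_means)
    also have "\<dots> = translate G \<gamma> y" by (simp only: s(3))
    also have "\<dots> = x"
      unfolding y_def using \<gamma> xm translate_mult[of x \<gamma> "inv \<gamma>"] translate_one[of x] by simp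
    finally have "k \<in> stabilizer x" using \<gamma> s(2) by (simp add: stabilizer_def k_def)
    moreover have "s = inv \<gamma> \<otimes> k \<otimes> \<gamma>"
      using \<gamma> s(2) by (simp add: k_def m_assoc inv_solve_left)
    ultimately have "s \<in> conjugate G (stabilizer x) \<gamma>" unfolding mem_conjugate by blast
    with s(1) show ?thesis by blast
  qed
  then show ?thesis using amenable_stabilizer[OF xm] by blast
qed

end

theorem corollary2:
  fixes G :: "('a, 'b) monoid_scheme"
  assumes "group G"
  shows "\<exists>H. amenable_subgroup H G \<and>
           (\<forall>S. finite S \<and> S \<subseteq> carrier G \<and> amenably_visible G S \<longrightarrow>
             (\<forall>\<gamma>\<in>carrier G. conjugate G H \<gamma> \<inter> S \<noteq> {}))"
  using group.exists_amenable_subgroup_meeting_visible[OF assms] by blast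

end
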